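(* Let $N\ge1$, $n\ge 1$. Let $\mathcal J_0^\pm(k)$ be a regular solution of the matrix Riemann-Hilbert problem described in the context, with jump matrix $\mathcal J(k)$. Let $k_1^+,\dots,k_N^+\in\mathbb C^+$ be pairwise distinct, $k_1^-,\dots,k_N^-\in\mathbb C^-$ pairwise distinct, and let $\mathcal V_j,\mathcal U_j\subseteq\mathbb C^{n+1}$, $j=1,\dots,N$, be given subspaces such that all projectors in the definition of the dressing factors of degree $1$ in the context exist (for every permutation). Let $D_{1\dots N}(k)$ be the corresponding dressing factor of degree $N$. Then $D_{1\dots N}(k)$ can be decomposed into $N!$ equivalent products of $N$ dressing factors of degree $1$: for every permutation $(i_1,\dots,i_N)$ of $(1,\dots,N)$, $$D_{1\dots N}(k)=D_{i_1}(k)\,D_{i_2,\{i_1\}}(k)\cdots D_{i_N,\{i_1\dots i_{N-1}\}}(k).$$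
   Context: $\mathbb C^\pm$ denotes the open upper/lower half-plane. Riemann-Hilbert (RH) problem: given an $(n+1)\times(n+1)$ jump matrix $\mathcal J(k)$ with $\det\mathcal J(k)\ne0$ for $k\in\mathbb R$, find matrix functions $\mathcal J^\pm(k)$, analytic in $\mathbb C^\pm$ (and continuous up to $\mathbb R$), with $$\mathcal J^+(k)\mathcal J^-(k)=\mathcal J(k)\ (k\in\mathbb R),\qquad \mathcal J^\pm(k)\to I_{n+1}\ \text{as }|k|\to\infty .$$ A regular solution is one with $\det\mathcal J_0^\pm(k)\neq0$ everywhere in the closed half-planes. A matrix function $M(k)$ is singular at $k_0$ if $\det M(k_0)=0$ and, near $k_0$, $M(k)=M_0+(k-k_0)M_1+O((k-k_0)^2)$ and $M^{-1}(k)=\frac{N_0}{k-k_0}+N_1+O(k-k_0)$. A solution of the RH problem with zeroes at $k_j^\pm$, $j=1,\dots,N$, is a solution such that $\mathcal J^\pm$ is singular at $k_1^\pm,\dots,k_N^\pm$ (and has nonvanishing determinant elsewhere). Such a solution is uniquely determined by the subspaces $\mathrm{Im}\,\mathcal J^+(k_j^+)$ and $\mathrm{Ker}\,\mathcal J^-(k_j^-)$. Dressing factors of degree $1$: for a permutation $(i_1,\dots,i_N)$ of $(1,\dots,N)$ and $1\le\ell\le N$, define recursively $$D_{i_\ell,\{i_1\dots i_{\ell-1}\}}(k)=I_{n+1}+\frac{k_{i_\ell}^--k_{i_\ell}^+}{k-k_{i_\ell}^-}\,\Pi_{i_\ell,\{i_1\dots i_{\ell-1}\}},$$ where $\Pi_{i_\ell,\{i_1\dots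 i_{\ell-1}\}}$ is the projector with $$\mathrm{Ker}\,\Pi_{i_\ell,\{i_1\dots i_{\ell-1}\}}=\big[D_{i_1}(k_{i_\ell}^+)\cdots D_{i_{\ell-1},\{i_1\dots i_{\ell-2}\}}(k_{i_\ell}^+)\big]^{-1}\big(\mathcal J_0^+(k_{i_\ell}^+)\big)^{-1}\mathcal V_{i_\ell},$$ $$\mathrm{Im}\,\Pi_{i_\ell,\{i_1\dots i_{\ell-1}\}}=\big[D_{i_1}(k_{i_\ell}^-)\cdots D_{i_{\ell-1},\{i_1\dots i_{\ell-2}\}}(k_{i_\ell}^-)\big]^{-1}\mathcal J_0^-(k_{i_\ell}^-)\,\mathcal U_{i_\ell}.$$ For $\ell=1$ the bracketed product is empty (the identity) and $D_{i_1,\{\}}$ is written $D_{i_1}$. The projector exists exactly when the prescribed kernel and image are complementary subspaces of $\mathbb C^{n+1}$. Dressing factor of degree $N$: $D_{1\dots N}(k)$ is the matrix function that transforms the regular solution $\mathcal J_0^\pm$ into the solution $\mathcal J^\pm$ of the same RH problem with zeroes at $k_j^\pm$ satisfying $\mathrm{Im}\,\mathcal J^+(k_j^+)=\mathcal V_j$ and $\mathrm{Ker}\,\mathcal J^-(k_j^-)=\mathcal U_j$ for $j=1,\dots,N$, i.e. $$\mathcal J^+(k)=\mathcal J_0^+(k)D_{1\dots N}(k),\qquad \mathcal J^-(k)=D_{1\dots N}(k)^{-1}\mathcal J_0^-(k).$$ *)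

theory Defs
  imports
    "HOL-Analysis.Analysis"
    "HOL-Library.Landau_Symbols"
    "HOL-Combinatorics.Permutations"
begin

section \<open>Matrix-valued functions\<close>

text \<open>Scalars of type \<^typ>\<open>complex\<close> acting on matrices; the library has only \<^const>\<open>scaleR\<close> here.\<close>

definition cscale :: "complex \<Rightarrow> complex^'m^'m \<Rightarrow> complex^'m^'m" (infixr \<open>*\<^sub>C\<close> 75)
  where "c *\<^sub>C A = (\<chi> i j. c * A $ i $ j)"

definition matrix_product :: "(complex^'m^'m) list \<Rightarrow> complex^'m^'m"
  where "matrix_product As = foldr (**) As (mat 1)"

definition matrix_kernel :: "complex^'m^'m \<Rightarrow> (complex^'m) set"
  where "matrix_kernel A = {x. A *v x = 0}"

definition matrix_image :: "complex^'m^'m \<Rightarrow> (complex^'m) set"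
  where "matrix_image A = range (\<lambda>x. A *v x)"

definition matrix_holomorphic_on :: "(complex \<Rightarrow> complex^'m^'m) \<Rightarrow> complex set \<Rightarrow> bool"
  where "matrix_holomorphic_on M S \<longleftrightarrow> (\<forall>i j. (\<lambda>k. M k $ i $ j) holomorphic_on S)"

text \<open>
  The second expansion is that of the inverse on a punctured neighbourhood of \<open>k0\<close>. Invertibility
  there is demanded explicitly, because \<^const>\<open>matrix_inv\<close> is unspecified on singular matrices.
\<close>

definition singular_at :: "(complex \<Rightarrow> complex^'m^'m) \<Rightarrow> complex \<Rightarrow> bool"
  where "singular_at M k0 \<longleftrightarrow>
    det (M k0) = 0 \<and>
    (\<exists>M0 M1. (\<lambda>k. norm (M k - (M0 + (k - k0) *\<^sub>C M1)))
               \<in> O[nhds k0](\<lambda>k. norm (k - k0) ^ 2)) \<and>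
    (\<forall>\<^sub>F k in at k0. invertible (M k)) \<and>
    (\<exists>N0 N1. (\<lambda>k. norm (matrix_inv (M k) - ((1 / (k - k0)) *\<^sub>C N0 + N1)))
               \<in> O[at k0](\<lambda>k. norm (k - k0)))"


section \<open>The Riemann-Hilbert problem\<close>

definition rh_solution ::
    "(real \<Rightarrow> complex^'m^'m) \<Rightarrow> (complex \<Rightarrow> complex^'m^'m) \<Rightarrow> (complex \<Rightarrow> complex^'m^'m) \<Rightarrow> bool"
  where "rh_solution J Jp Jm \<longleftrightarrow>
    matrix_holomorphic_on Jp {k. Im k > 0} \<and> continuous_on {k. Im k \<ge> 0} Jp \<and>
    matrix_holomorphic_on Jm {k. Im k < 0} \<and> continuous_on {k. Im k \<le> 0} Jm \<and>
    (\<forall>x. Jp (of_real x) ** Jm (of_real x) = J x) \<and>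
    (Jp \<longlongrightarrow> mat 1) (inf at_infinity (principal {k. Im k \<ge> 0})) \<and>
    (Jm \<longlongrightarrow> mat 1) (inf at_infinity (principal {k. Im k \<le> 0}))"

definition regular_rh_solution ::
    "(real \<Rightarrow> complex^'m^'m) \<Rightarrow> (complex \<Rightarrow> complex^'m^'m) \<Rightarrow> (complex \<Rightarrow> complex^'m^'m) \<Rightarrow> bool"
  where "regular_rh_solution J Jp Jm \<longleftrightarrow>
    rh_solution J Jp Jm \<and>
    (\<forall>k. Im k \<ge> 0 \<longrightarrow> det (Jp k) \<noteq> 0) \<and>
    (\<forall>k. Im k \<le> 0 \<longrightarrow> det (Jm k) \<noteq> 0)"

definition rh_solution_with_zeroes ::
    "nat \<Rightarrow> (nat \<Rightarrow> complex) \<Rightarrow> (nat \<Rightarrow> complex) \<Rightarrow>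
     (real \<Rightarrow> complex^'m^'m) \<Rightarrow> (complex \<Rightarrow> complex^'m^'m) \<Rightarrow> (complex \<Rightarrow> complex^'m^'m) \<Rightarrow> bool"
  where "rh_solution_with_zeroes N kp km J Jp Jm \<longleftrightarrow>
    rh_solution J Jp Jm \<and>
    (\<forall>j\<in>{1..N}. singular_at Jp (kp j) \<and> singular_at Jm (km j)) \<and>
    (\<forall>k. Im k \<ge> 0 \<and> k \<notin> kp ` {1..N} \<longrightarrow> det (Jp k) \<noteq> 0) \<and>
    (\<forall>k. Im k \<le> 0 \<and> k \<notin> km ` {1..N} \<longrightarrow> det (Jm k) \<noteq> 0)"


section \<open>The dressing factor of degree \<open>N\<close>\<close>

text \<open>
  \<open>D\<close> has poles at the points \<open>km j\<close>, so its values there carry no meaning and are left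
  unconstrained; \<open>Jm (km j)\<close> is determined by continuity of \<open>Jm\<close>.
\<close>

definition is_dressing_factor ::
    "nat \<Rightarrow> (nat \<Rightarrow> complex) \<Rightarrow> (nat \<Rightarrow> complex) \<Rightarrow>
     (nat \<Rightarrow> (complex^'m) set) \<Rightarrow> (nat \<Rightarrow> (complex^'m) set) \<Rightarrow>
     (real \<Rightarrow> complex^'m^'m) \<Rightarrow> (complex \<Rightarrow> complex^'m^'m) \<Rightarrow> (complex \<Rightarrow> complex^'m^'m) \<Rightarrow>
     (complex \<Rightarrow> complex^'m^'m) \<Rightarrow> bool"
  where "is_dressing_factor N kp km V U J J0p J0m D \<longleftrightarrow>
    (\<exists>Jp Jm. rh_solution_with_zeroes N kp km J Jp Jm \<and>
      (\<forall>j\<in>{1..N}. matrix_image (Jp (kp j)) = V j \<and> matrix_kernel (Jm (km j)) = U j) \<and>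
      (\<forall>k. Im k \<ge> 0 \<longrightarrow> Jp k = J0p k ** D k) \<and>
      (\<forall>k. Im k \<le> 0 \<and> k \<notin> km ` {1..N} \<longrightarrow>
         invertible (D k) \<and> Jm k = matrix_inv (D k) ** J0m k))"


section \<open>Dressing factors of degree 1\<close>

definition is_projector :: "(complex^'m) set \<Rightarrow> (complex^'m) set \<Rightarrow> complex^'m^'m \<Rightarrow> bool"
  where "is_projector K R P \<longleftrightarrow> P ** P = P \<and> matrix_kernel P = K \<and> matrix_image P = R"

definition projector :: "(complex^'m) set \<Rightarrow> (complex^'m) set \<Rightarrow> complex^'m^'m"
  where "projector K R = (THE P. is_projector K R P)"

text \<open>
  Kernel and image prescribed for the projector with index \<open>i\<close>; the argument \<open>B\<close> is the bracketed
  product of the preceding factors, as a function of \<open>k\<close>.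
\<close>

definition prescribed_kernel ::
    "(nat \<Rightarrow> complex) \<Rightarrow> (nat \<Rightarrow> (complex^'m) set) \<Rightarrow> (complex \<Rightarrow> complex^'m^'m) \<Rightarrow>
     (complex \<Rightarrow> complex^'m^'m) \<Rightarrow> nat \<Rightarrow> (complex^'m) set"
  where "prescribed_kernel kp V J0p B i =
    (\<lambda>x. (matrix_inv (B (kp i)) ** matrix_inv (J0p (kp i))) *v x) ` V i"

definition prescribed_image ::
    "(nat \<Rightarrow> complex) \<Rightarrow> (nat \<Rightarrow> (complex^'m) set) \<Rightarrow> (complex \<Rightarrow> complex^'m^'m) \<Rightarrow>
     (complex \<Rightarrow> complex^'m^'m) \<Rightarrow> nat \<Rightarrow> (complex^'m) set"
  where "prescribed_image km U J0m B i =
    (\<lambda>x. (matrix_inv (B (km i)) ** J0m (km i)) *v x) ` U i"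

text \<open>
  With \<open>i\<^sub>m = \<sigma> m\<close>, \<open>degree1_factor kp km V U J0p J0m \<sigma> l\<close> is
  $D_{i_l,\{i_1\dots i_{l-1}\}}$ for \<open>l \<ge> 1\<close>.
\<close>

fun degree1_factor ::
    "(nat \<Rightarrow> complex) \<Rightarrow> (nat \<Rightarrow> complex) \<Rightarrow>
     (nat \<Rightarrow> (complex^'m) set) \<Rightarrow> (nat \<Rightarrow> (complex^'m) set) \<Rightarrow>
     (complex \<Rightarrow> complex^'m^'m) \<Rightarrow> (complex \<Rightarrow> complex^'m^'m) \<Rightarrow>
     (nat \<Rightarrow> nat) \<Rightarrow> nat \<Rightarrow> complex \<Rightarrow> complex^'m^'m"
  where "degree1_factor kp km V U J0p J0m \<sigma> l k =
    (let B = (\<lambda>k'. matrix_product (map (\<lambda>m. degree1_factor kp km V U J0p J0m \<sigma> m k') [1..<l]))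
     in mat 1 + ((km (\<sigma> l) - kp (\<sigma> l)) / (k - km (\<sigma> l))) *\<^sub>C
          projector (prescribed_kernel kp V J0p B (\<sigma> l)) (prescribed_image km U J0m B (\<sigma> l)))"

declare degree1_factor.simps [simp del]

definition degree1_product ::
    "(nat \<Rightarrow> complex) \<Rightarrow> (nat \<Rightarrow> complex) \<Rightarrow>
     (nat \<Rightarrow> (complex^'m) set) \<Rightarrow> (nat \<Rightarrow> (complex^'m) set) \<Rightarrow>
     (complex \<Rightarrow> complex^'m^'m) \<Rightarrow> (complex \<Rightarrow> complex^'m^'m) \<Rightarrow>
     (nat \<Rightarrow> nat) \<Rightarrow> nat \<Rightarrow> complex \<Rightarrow> complex^'m^'m"
  where "degree1_product kp km V U J0p J0m \<sigma> l k =
    matrix_product (map (\<lambda>m. degree1_factor kp km V U J0p J0m \<sigma> m k) [1..<Suc l])"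

definition degree1_projector_exists ::
    "(nat \<Rightarrow> complex) \<Rightarrow> (nat \<Rightarrow> complex) \<Rightarrow>
     (nat \<Rightarrow> (complex^'m) set) \<Rightarrow> (nat \<Rightarrow> (complex^'m) set) \<Rightarrow>
     (complex \<Rightarrow> complex^'m^'m) \<Rightarrow> (complex \<Rightarrow> complex^'m^'m) \<Rightarrow>
     (nat \<Rightarrow> nat) \<Rightarrow> nat \<Rightarrow> bool"
  where "degree1_projector_exists kp km V U J0p J0m \<sigma> l \<longleftrightarrow>
    (let B = degree1_product kp km V U J0p J0m \<sigma> (l - 1)
     in \<exists>P. is_projector (prescribed_kernel kp V J0p B (\<sigma> l)) (prescribed_image km U J0m B (\<sigma> l)) P)"

end

theory Submission
  imports Defs "HOL-Complex_Analysis.Complex_Analysis"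
begin

text \<open>
  Let \<open>B\<close> be the product of the factors of degree 1. Its inverse \<open>C\<close> is the product, in reverse
  order, of the inverse factors, so \<open>C\<close> has poles only at the \<open>kp j\<close>, while \<open>D\<close> has poles only at
  the \<open>km j\<close> and is holomorphic across the real line, where both of its descriptions, by
  \<open>J0p\<close> and \<open>Jp\<close> above and by \<open>J0m\<close> and \<open>Jm\<close> below, are valid. The prescribed kernels make the residue
  of \<open>C D\<close> vanish at \<open>kp j\<close>, and the prescribed images make it vanish at \<open>km j\<close>. Hence \<open>C D\<close>
  is entire; it tends to the identity at infinity, so it is the identity by Liouville's theorem.
\<close>

text \<open>Formal power series also use \<open>$\<close>, which would make the notation for vector
  components ambiguous.\<close>

unbundle no fps_syntax

section \<open>Matrix-valued functions\<close>

lemma matrix_inv_inverse: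
  fixes A :: "'a::semiring_1^'n^'n"
  assumes "invertible A"
  shows "A ** matrix_inv A = mat 1" "matrix_inv A ** A = mat 1"
  using someI_ex[OF assms[unfolded invertible_def]] unfolding matrix_inv_def by auto

lemma matrix_inv_eqI:
  fixes A B :: "'a::field^'n^'n"
  assumes "A ** B = mat 1"
  shows "matrix_inv A = B"
proof -
  have "invertible A" using assms invertible_right_inverse by blast
  then have "matrix_inv A ** (A ** B) = B"
    by (simp add: matrix_mul_assoc matrix_inv_inverse)
  then show ?thesis using assms by simp
qed

text \<open>Cramer's rule for the columns of \<open>A ** matrix_inv A = mat 1\<close>. It presents
  each entry of the inverse as a rational expression in the entries of \<open>A\<close>, from which
  continuity and holomorphy of inverses follow.\<close>

lemma matrix_inv_nth:
  fixes A :: "'a::field^'n^'n"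
  assumes "det A \<noteq> 0"
  shows "matrix_inv A $ i $ j =
    det (\<chi> a b. if b = i then mat 1 $ a $ j else A $ a $ b) / det A"
proof -
  have "invertible A" using assms invertible_det_nz by blast
  then have "A ** matrix_inv A = mat 1" by (rule matrix_inv_inverse)
  then have "A *v column j (matrix_inv A) = column j (mat 1)"
    by (simp add: vec_eq_iff matrix_vector_mult_def column_def matrix_matrix_mult_def)
  then have "column j (matrix_inv A) = (\<chi> k. det (\<chi> a b. if b = k then column j (mat 1) $ a else A $ a $ b) / det A)"
    using cramer[OF assms] by blast
  then have "column j (matrix_inv A) $ i = det (\<chi> a b. if b = i then column j (mat 1) $ a else A $ a $ b) / det A"
    by simp
  then show ?thesis by (simp add: column_def cong: if_cong)
qed

lemma cscale_nth [simp]: "(c *\<^sub>C A) $ i $ j = c * A $ i $ j"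
  by (simp add: cscale_def)

lemma matrix_mult_0 [simp]:
  fixes A :: "'a::semiring_1^'n^'m"
  shows "A ** (0 :: 'a^'k^'n) = 0" "(0 :: 'a^'m^'k) ** A = 0"
  by (simp_all add: vec_eq_iff matrix_matrix_mult_def)

lemma matrix_add_rdistrib:
  fixes A B :: "'a::semiring_1^'n^'m"
  shows "(A + B) ** C = A ** C + B ** C"
  by (simp add: vec_eq_iff matrix_matrix_mult_def distrib_right sum.distrib)

lemma cscale_0 [simp]: "c *\<^sub>C 0 = 0"
  and cscale_zero [simp]: "0 *\<^sub>C A = 0"
  and cscale_cscale: "c *\<^sub>C d *\<^sub>C A = (c * d) *\<^sub>C A"
  and cscale_add_right: "c *\<^sub>C (A + B) = c *\<^sub>C A + c *\<^sub>C B"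
  and cscale_add_left: "(c + d) *\<^sub>C A = c *\<^sub>C A + d *\<^sub>C A"
  by (simp_all add: vec_eq_iff algebra_simps)

lemma cscale_mult_left: "(c *\<^sub>C A) ** B = c *\<^sub>C (A ** B)"
  and cscale_mult_right: "A ** (c *\<^sub>C B) = c *\<^sub>C (A ** B)"
  by (simp_all add: vec_eq_iff matrix_matrix_mult_def sum_distrib_left mult_ac)

section \<open>Limits, continuity and holomorphy of products, determinants and inverses\<close>

lemma tendsto_matrix_nth_iff:
  fixes f :: "'b \<Rightarrow> 'a::topological_space^'n^'m"
  shows "(f \<longlongrightarrow> A) F \<longleftrightarrow> (\<forall>i j. ((\<lambda>x. f x $ i $ j) \<longlongrightarrow> A $ i $ j) F)"
proof
  show "(f \<longlongrightarrow> A) F \<Longrightarrow> \<forall>i j. ((\<lambda>x. f x $ i $ j) \<longlongrightarrow> A $ i $ j) F"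
    by (intro allI tendsto_vec_nth)
  show "\<forall>i j. ((\<lambda>x. f x $ i $ j) \<longlongrightarrow> A $ i $ j) F \<Longrightarrow> (f \<longlongrightarrow> A) F"
    by (intro vec_tendstoI) auto
qed

lemma tendsto_matrix_mult [tendsto_intros]:
  fixes f :: "'b \<Rightarrow> 'a::{topological_semigroup_mult,topological_comm_monoid_add,semiring_1}^'n^'m"
  assumes "(f \<longlongrightarrow> A) F" "(g \<longlongrightarrow> B) F"
  shows "((\<lambda>x. f x ** g x) \<longlongrightarrow> A ** B) F"
  unfolding matrix_matrix_mult_def using assms by (intro tendsto_intros) auto

lemma tendsto_cscale [tendsto_intros]:
  assumes "(c \<longlongrightarrow> d) F" "(f \<longlongrightarrow> A) F"
  shows "((\<lambda>x. c x *\<^sub>C f x) \<longlongrightarrow> d *\<^sub>C A) F"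
  unfolding cscale_def using assms by (intro tendsto_intros)

lemma tendsto_det [tendsto_intros]:
  fixes f :: "'b \<Rightarrow> 'a::real_normed_field^'n^'n"
  assumes "(f \<longlongrightarrow> A) F"
  shows "((\<lambda>x. det (f x)) \<longlongrightarrow> det A) F"
  unfolding det_def using assms by (intro tendsto_intros)

text \<open>Invertibility is required of the limit alone: the determinant is continuous, so
  \<open>f x\<close> is eventually invertible, and there Cramer's formula applies.\<close>

lemma tendsto_matrix_inv:
  fixes f :: "'b \<Rightarrow> 'a::real_normed_field^'n^'n"
  assumes f: "(f \<longlongrightarrow> A) F" and A: "det A \<noteq> 0"
  shows "((\<lambda>x. matrix_inv (f x)) \<longlongrightarrow> matrix_inv A) F"
proof -
  have ev: "\<forall>\<^sub>F x in F. det (f x) \<noteq> 0"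
    using tendsto_imp_eventually_ne[OF tendsto_det[OF f] A] .
  have "((\<lambda>x. matrix_inv (f x) $ i $ j) \<longlongrightarrow> matrix_inv A $ i $ j) F" for i j
  proof -
    have "((\<lambda>x. if b = i then mat 1 $ a $ j else f x $ a $ b) \<longlongrightarrow>
        (if b = i then mat 1 $ a $ j else A $ a $ b)) F" for a b
      using f by (auto intro!: tendsto_intros)
    then have "((\<lambda>x. det (\<chi> a b. if b = i then mat 1 $ a $ j else f x $ a $ b) / det (f x)) \<longlongrightarrow>
        det (\<chi> a b. if b = i then mat 1 $ a $ j else A $ a $ b) / det A) F"
      using f A by (intro tendsto_intros)
    then have "((\<lambda>x. matrix_inv (f x) $ i $ j) \<longlongrightarrow>
        det (\<chi> a b. if b = i then mat 1 $ a $ j else A $ a $ b) / det A) F"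
      by (rule Lim_transform_eventually) (use ev in eventually_elim, simp add: matrix_inv_nth)
    then show ?thesis by (simp add: matrix_inv_nth[OF A])
  qed
  then show ?thesis by (simp add: tendsto_matrix_nth_iff)
qed

lemma continuous_on_matrix_mult [continuous_intros]:
  fixes f :: "'b::topological_space \<Rightarrow> 'a::{topological_semigroup_mult,topological_comm_monoid_add,semiring_1}^'n^'m"
  assumes "continuous_on S f" "continuous_on S g"
  shows "continuous_on S (\<lambda>x. f x ** g x)"
  using assms by (auto simp: continuous_on_def intro: tendsto_matrix_mult)

lemma continuous_on_matrix_inv:
  fixes f :: "'b::topological_space \<Rightarrow> 'a::real_normed_field^'n^'n"
  assumes "continuous_on S f" "\<And>x. x \<in> S \<Longrightarrow> det (f x) \<noteq> 0"
  shows "continuous_on S (\<lambda>x. matrix_inv (f x))"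
  using assms by (auto simp: continuous_on_def intro: tendsto_matrix_inv)

lemma matrix_holomorphic_on_subset:
  "matrix_holomorphic_on M S \<Longrightarrow> T \<subseteq> S \<Longrightarrow> matrix_holomorphic_on M T"
  unfolding matrix_holomorphic_on_def using holomorphic_on_subset by blast

lemma matrix_holomorphic_on_cong:
  assumes "\<And>k. k \<in> S \<Longrightarrow> M k = M' k"
  shows "matrix_holomorphic_on M S \<longleftrightarrow> matrix_holomorphic_on M' S"
  unfolding matrix_holomorphic_on_def using assms by (auto cong: holomorphic_cong)

lemma matrix_holomorphic_on_const: "matrix_holomorphic_on (\<lambda>_. A) S"
  unfolding matrix_holomorphic_on_def by simp

lemma matrix_holomorphic_on_mult:
  assumes "matrix_holomorphic_on M S" "matrix_holomorphic_on M' S"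
  shows "matrix_holomorphic_on (\<lambda>k. M k ** M' k) S"
  using assms unfolding matrix_holomorphic_on_def matrix_matrix_mult_def
  by (auto intro!: holomorphic_intros)

lemma holomorphic_on_det:
  assumes "matrix_holomorphic_on M S"
  shows "(\<lambda>k. det (M k)) holomorphic_on S"
  using assms unfolding matrix_holomorphic_on_def det_def
  by (auto intro!: holomorphic_intros)

lemma matrix_holomorphic_on_inv:
  assumes M: "matrix_holomorphic_on M S" and nz: "\<And>k. k \<in> S \<Longrightarrow> det (M k) \<noteq> 0"
  shows "matrix_holomorphic_on (\<lambda>k. matrix_inv (M k)) S"
  unfolding matrix_holomorphic_on_def
proof (intro allI)
  fix i j
  let ?N = "\<lambda>k. \<chi> a b. if b = i then mat 1 $ a $ j else M k $ a $ b"
  have "(\<lambda>k. ?N k $ a $ b) holomorphic_on S" for a b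
    using M by (cases "b = i") (auto simp: matrix_holomorphic_on_def)
  then have "matrix_holomorphic_on ?N S"
    unfolding matrix_holomorphic_on_def by blast
  then have "(\<lambda>k. det (?N k) / det (M k)) holomorphic_on S"
    using M nz by (intro holomorphic_intros holomorphic_on_det)
  then show "(\<lambda>k. matrix_inv (M k) $ i $ j) holomorphic_on S"
    by (rule holomorphic_transform) (simp add: matrix_inv_nth nz)
qed

lemma matrix_holomorphic_on_imp_continuous_on:
  assumes "matrix_holomorphic_on M S"
  shows "continuous_on S M"
proof -
  have "continuous_on S (\<lambda>k. M k $ i $ j)" for i j
    using assms holomorphic_on_imp_continuous_on unfolding matrix_holomorphic_on_def by blast
  then show ?thesis
    by (simp add: continuous_on_def tendsto_matrix_nth_iff)
qed

section \<open>Liouville's theorem off a finite set\<close>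

text \<open>Riemann's removable singularity theorem, one point at a time. The function is arbitrary
  in the induction because each step replaces it by its extension across the point just
  treated.\<close>

lemma removable_finite_set:
  assumes "finite K" "f holomorphic_on - K"
    and "\<And>s. s \<in> K \<Longrightarrow> ((\<lambda>z. (z - s) * f z) \<longlongrightarrow> 0) (at s)"
  shows "\<exists>g. g holomorphic_on UNIV \<and> (\<forall>z. z \<notin> K \<longrightarrow> g z = f z)"
  using assms
proof (induction K arbitrary: f rule: finite_induct)
  case empty
  then show ?case by auto
next
  case (insert x K)
  have op: "open (- K)" using insert.hyps by (simp add: finite_imp_closed open_Compl)
  have "f holomorphic_on - K - {x}"
    using insert.prems(1) by (rule holomorphic_on_subset) auto
  moreover have "x \<in> interior (- K)" using op insert.hyps by (simp add: interior_open)
  ultimately obtain g where g: "g holomorphic_on - K" "\<forall>z\<in>- K - {x}. g z = f z"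
    using holomorphic_on_extend_lim insert.prems(2)[of x] by blast
  have "((\<lambda>z. (z - s) * g z) \<longlongrightarrow> 0) (at s)" if s: "s \<in> K" for s
  proof (rule Lim_transform_within_open)
    show "((\<lambda>z. (z - s) * f z) \<longlongrightarrow> 0) (at s)" using insert.prems(2) s by blast
    \<comment> \<open>Deleting every exceptional point other than \<open>s\<close> leaves a
      neighbourhood of \<open>s\<close> on which the extension and the original function agree off
      \<open>s\<close>.\<close>
    show "open (- (insert x K - {s}))" using insert.hyps
      by (intro open_Compl finite_imp_closed) auto
    show "s \<in> - (insert x K - {s})" by simp
    show "(z - s) * f z = (z - s) * g z" if "z \<in> - (insert x K - {s})" "z \<noteq> s" for z
      using that g(2) by auto
  qed
  from insert.IH[OF g(1) this] g(2) show ?case by auto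
qed

text \<open>Each entry extends to an entire function. The extension has the same limit at infinity,
  since \<open>K\<close> is bounded, and is therefore constant.\<close>

lemma matrix_Liouville_off_finite:
  fixes F :: "complex \<Rightarrow> complex^'m^'m"
  assumes K: "finite K" and hol: "matrix_holomorphic_on F (- K)"
    and K0: "\<And>s. s \<in> K \<Longrightarrow> ((\<lambda>k. (k - s) *\<^sub>C F k) \<longlongrightarrow> 0) (at s)"
    and inf: "(F \<longlongrightarrow> L) at_infinity" and k: "k \<notin> K"
  shows "F k = L"
proof -
  have "F k $ i $ j = L $ i $ j" for i j
  proof -
    have "\<exists>g. g holomorphic_on UNIV \<and> (\<forall>z. z \<notin> K \<longrightarrow> g z = F z $ i $ j)"
    proof (rule removable_finite_set[OF K])
      show "(\<lambda>z. F z $ i $ j) holomorphic_on - K" using hol matrix_holomorphic_on_def by blast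
      show "((\<lambda>z. (z - s) * F z $ i $ j) \<longlongrightarrow> 0) (at s)" if "s \<in> K" for s
        using K0[OF that] by (simp add: tendsto_matrix_nth_iff)
    qed
    then obtain g where g: "g holomorphic_on UNIV" "\<And>z. z \<notin> K \<Longrightarrow> g z = F z $ i $ j" by blast
    have "bounded K" using K by (simp add: finite_imp_bounded)
    then obtain B where B: "\<And>z. z \<in> K \<Longrightarrow> norm z \<le> B" by (auto simp: bounded_iff)
    have ev: "\<forall>\<^sub>F z in at_infinity. F z $ i $ j = g z"
      unfolding eventually_at_infinity
    proof (intro exI allI impI)
      fix z :: complex assume "B + 1 \<le> norm z"
      then have "z \<notin> K" using B[of z] by linarith
      then show "F z $ i $ j = g z" using g(2) by simp
    qed
    have "((\<lambda>z. F z $ i $ j) \<longlongrightarrow> L $ i $ j) at_infinity"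
      using inf by (simp add: tendsto_matrix_nth_iff)
    then have "(g \<longlongrightarrow> L $ i $ j) at_infinity"
      using ev by (rule Lim_transform_eventually)
    then show ?thesis using Liouville_weak[OF g(1)] g(2)[OF k] by metis
  qed
  then show ?thesis by (simp add: vec_eq_iff)
qed

text \<open>Joins the limits at infinity along the two closed half-planes.\<close>

lemma tendsto_inf_principal_Un:
  assumes "(f \<longlongrightarrow> l) (inf F (principal A))" "(f \<longlongrightarrow> l) (inf F (principal B))" "A \<union> B = UNIV"
  shows "(f \<longlongrightarrow> l) F"
proof (rule topological_tendstoI)
  fix S assume "open S" "l \<in> S"
  then have "\<forall>\<^sub>F x in F. x \<in> A \<longrightarrow> f x \<in> S" "\<forall>\<^sub>F x in F. x \<in> B \<longrightarrow> f x \<in> S"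
    using assms(1,2) by (auto simp: tendsto_def eventually_inf_principal)
  then show "\<forall>\<^sub>F x in F. f x \<in> S"
    by eventually_elim (use assms(3) in auto)
qed

text \<open>A continuous function that is holomorphic on both sides of a line is holomorphic across
  it; this is applied entrywise to the real line.\<close>

lemma matrix_holomorphic_on_paste:
  assumes "open S" "matrix_holomorphic_on F (S \<inter> {k. Im k > 0})"
    "matrix_holomorphic_on F (S \<inter> {k. Im k < 0})" "continuous_on S F"
  shows "matrix_holomorphic_on F S"
  unfolding matrix_holomorphic_on_def
proof (intro allI)
  fix i j
  \<comment> \<open>The real line is the line orthogonal to \<open>\<i>\<close> through the
    origin.\<close>
  have im: "\<i> \<bullet> z = Im z" for z by (simp add: inner_complex_def)
  show "(\<lambda>k. F k $ i $ j) holomorphic_on S"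
    by (rule holomorphic_on_paste_across_line[OF assms(1), of \<i> _ 0])
      (use assms in \<open>auto simp: im matrix_holomorphic_on_def intro!: continuous_intros\<close>)
qed

section \<open>Products of elementary factors\<close>

text \<open>For a projector \<open>P\<close> this is multiplication by
  \<open>(k - q) / (k - r)\<close> on the image of \<open>P\<close> and the identity on its kernel.
  Thus \<open>r\<close> is the pole, and at \<open>k = q\<close> the factor degenerates to
  \<open>mat 1 - P\<close>.\<close>

definition elementary_factor ::
    "complex \<Rightarrow> complex \<Rightarrow> complex^'m^'m \<Rightarrow> complex \<Rightarrow> complex^'m^'m"
  where "elementary_factor q r P k = mat 1 + ((r - q) / (k - r)) *\<^sub>C P"

text \<open>Exchanging \<open>q\<close> and \<open>r\<close> inverts the scalar
  \<open>(k - q) / (k - r)\<close>. With \<open>a\<close> and \<open>b\<close> as in the proof, this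
  is \<open>(1 + a) * (1 + b) = 1\<close>.\<close>

lemma elementary_factor_inverse:
  assumes "P ** P = P" "k \<noteq> q" "k \<noteq> r"
  shows "elementary_factor q r P k ** elementary_factor r q P k = mat 1"
proof -
  define a b where "a = (r - q) / (k - r)" and "b = (q - r) / (k - q)"
  have "a + b + a * b = 0"
    using assms(2,3) unfolding a_def b_def by (simp add: divide_simps algebra_simps)
  moreover have "(mat 1 + a *\<^sub>C P) ** (mat 1 + b *\<^sub>C P) = mat 1 + (a + b + a * b) *\<^sub>C P"
    by (simp add: matrix_add_ldistrib matrix_add_rdistrib cscale_mult_left cscale_mult_right
        assms(1) cscale_cscale cscale_add_left cscale_add_right mult_ac add_ac)
  ultimately show ?thesis unfolding elementary_factor_def a_def b_def by simp
qed

lemma matrix_holomorphic_on_elementary_factor: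
  "r \<notin> S \<Longrightarrow> matrix_holomorphic_on (elementary_factor q r P) S"
  unfolding matrix_holomorphic_on_def elementary_factor_def
  by (auto intro!: holomorphic_intros)

lemma tendsto_elementary_factor_infinity:
  "(elementary_factor q r P \<longlongrightarrow> mat 1) at_infinity"
proof -
  have "((\<lambda>k. (r - q) / (k - r)) \<longlongrightarrow> 0) at_infinity"
    using tendsto_add_filterlim_at_infinity[OF tendsto_const filterlim_ident, of "- r"]
    by (intro tendsto_divide_0[OF tendsto_const]) simp
  then have "((\<lambda>k. mat 1 + ((r - q) / (k - r)) *\<^sub>C P) \<longlongrightarrow> mat 1 + 0 *\<^sub>C P) at_infinity"
    by (intro tendsto_intros)
  then show ?thesis by (simp add: elementary_factor_def[abs_def])
qed

lemma tendsto_elementary_factor: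
  "s \<noteq> r \<Longrightarrow> (elementary_factor q r P \<longlongrightarrow> elementary_factor q r P s) (at s)"
  unfolding elementary_factor_def[abs_def] by (intro tendsto_intros) auto

primrec elementary_product ::
    "(nat \<Rightarrow> complex) \<Rightarrow> (nat \<Rightarrow> complex) \<Rightarrow> (nat \<Rightarrow> complex^'m^'m) \<Rightarrow> nat \<Rightarrow> complex \<Rightarrow> complex^'m^'m"
  where
    "elementary_product q r P 0 k = mat 1"
  | "elementary_product q r P (Suc l) k =
      elementary_product q r P l k ** elementary_factor (q (Suc l)) (r (Suc l)) (P (Suc l)) k"

text \<open>Written out as a product, in reverse order and with \<open>q\<close> and
  \<open>r\<close> exchanged, instead of as a pointwise \<open>matrix_inv\<close>. Its poles can
  only be at the \<open>q j\<close>, and it takes the right values at the remaining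
  \<open>r j\<close>, where \<open>elementary_product\<close> may have poles.\<close>

primrec elementary_product_inv ::
    "(nat \<Rightarrow> complex) \<Rightarrow> (nat \<Rightarrow> complex) \<Rightarrow> (nat \<Rightarrow> complex^'m^'m) \<Rightarrow> nat \<Rightarrow> complex \<Rightarrow> complex^'m^'m"
  where
    "elementary_product_inv q r P 0 k = mat 1"
  | "elementary_product_inv q r P (Suc l) k =
      elementary_factor (r (Suc l)) (q (Suc l)) (P (Suc l)) k ** elementary_product_inv q r P l k"

lemma elementary_product_inverse:
  assumes "\<And>j. j \<in> {1..l} \<Longrightarrow> P j ** P j = P j" "k \<notin> q ` {1..l}" "k \<notin> r ` {1..l}"
  shows "elementary_product q r P l k ** elementary_product_inv q r P l k = mat 1"
  using assms
proof (induction l)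
  case (Suc l)
  let ?X = "elementary_product q r P l k" and ?Y = "elementary_product_inv q r P l k"
  let ?E = "elementary_factor (q (Suc l)) (r (Suc l)) (P (Suc l)) k"
  let ?E' = "elementary_factor (r (Suc l)) (q (Suc l)) (P (Suc l)) k"
  have "Suc l \<in> {1..Suc l}" by simp
  then have "k \<noteq> q (Suc l)" "k \<noteq> r (Suc l)" using Suc.prems(2,3) by blast+
  then have E: "?E ** ?E' = mat 1"
    using Suc.prems(1)[of "Suc l"] by (intro elementary_factor_inverse) auto
  have "?X ** ?E ** (?E' ** ?Y) = ?X ** (?E ** ?E') ** ?Y"
    by (simp only: matrix_mul_assoc)
  also have "\<dots> = ?X ** ?Y" by (simp add: E)
  also have "\<dots> = mat 1" using Suc.prems by (intro Suc.IH) auto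
  finally show ?case by simp
qed simp

lemma matrix_holomorphic_on_elementary_product:
  "r ` {1..l} \<inter> S = {} \<Longrightarrow> matrix_holomorphic_on (elementary_product q r P l) S"
proof (induction l)
  case (Suc l)
  have "Suc l \<in> {1..Suc l}" by simp
  with Suc.prems have "r (Suc l) \<notin> S" by blast
  moreover have "r ` {1..l} \<inter> S = {}" using Suc.prems by fastforce
  ultimately show ?case
    using Suc.IH unfolding elementary_product.simps[abs_def]
    by (intro matrix_holomorphic_on_mult matrix_holomorphic_on_elementary_factor) auto
qed (simp add: matrix_holomorphic_on_const elementary_product.simps[abs_def])

lemma matrix_holomorphic_on_elementary_product_inv:
  "q ` {1..l} \<inter> S = {} \<Longrightarrow> matrix_holomorphic_on (elementary_product_inv q r P l) S"
proof (induction l)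
  case (Suc l)
  have "Suc l \<in> {1..Suc l}" by simp
  with Suc.prems have "q (Suc l) \<notin> S" by blast
  moreover have "q ` {1..l} \<inter> S = {}" using Suc.prems by fastforce
  ultimately show ?case
    using Suc.IH unfolding elementary_product_inv.simps[abs_def]
    by (intro matrix_holomorphic_on_mult matrix_holomorphic_on_elementary_factor) auto
qed (simp add: matrix_holomorphic_on_const elementary_product_inv.simps[abs_def])

lemma matrix_holomorphic_on_imp_tendsto:
  assumes "matrix_holomorphic_on M S" "open S" "s \<in> S"
  shows "(M \<longlongrightarrow> M s) (at s)"
  using matrix_holomorphic_on_imp_continuous_on[OF assms(1)] assms(2,3)
  by (metis continuous_on_def at_within_open)

lemma tendsto_elementary_product_inv:
  assumes "s \<notin> q ` {1..l}"
  shows "(elementary_product_inv q r P l \<longlongrightarrow> elementary_product_inv q r P l s) (at s)"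
  by (rule matrix_holomorphic_on_imp_tendsto[of _ "- q ` {1..l}"])
    (use assms in \<open>auto intro!: matrix_holomorphic_on_elementary_product_inv
       open_Compl finite_imp_closed\<close>)

lemma tendsto_elementary_product_inv_infinity:
  "(elementary_product_inv q r P l \<longlongrightarrow> mat 1) at_infinity"
proof (induction l)
  case (Suc l)
  from tendsto_matrix_mult[OF tendsto_elementary_factor_infinity this] show ?case
    by (simp add: elementary_product_inv.simps[abs_def])
qed (simp add: elementary_product_inv.simps[abs_def])

text \<open>The factors with index above \<open>j\<close> multiply from the left and have no pole at
  \<open>s\<close>, so a vanishing residue stays zero.\<close>

lemma elementary_product_inv_residue_mono:
  assumes "((\<lambda>k. (k - s) *\<^sub>C (elementary_product_inv q r P j k ** M k)) \<longlongrightarrow> 0) (at s)"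
    and "j \<le> l" and "s \<notin> q ` {j<..l}"
  shows "((\<lambda>k. (k - s) *\<^sub>C (elementary_product_inv q r P l k ** M k)) \<longlongrightarrow> 0) (at s)"
  using assms(2,3)
proof (induction l rule: dec_induct)
  case base
  show ?case by (rule assms(1))
next
  case (step l)
  let ?E = "elementary_factor (r (Suc l)) (q (Suc l)) (P (Suc l))"
  have "Suc l \<in> {j<..Suc l}" using step.hyps by simp
  then have s: "s \<noteq> q (Suc l)" using step.prems by blast
  have "((\<lambda>k. (k - s) *\<^sub>C (elementary_product_inv q r P l k ** M k)) \<longlongrightarrow> 0) (at s)"
    using step.prems by (intro step.IH) auto
  from tendsto_matrix_mult[OF tendsto_elementary_factor[OF s] this]
  have "((\<lambda>k. ?E k ** ((k - s) *\<^sub>C (elementary_product_inv q r P l k ** M k))) \<longlongrightarrow> 0) (at s)"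
    by simp
  then show ?case by (simp add: cscale_mult_right matrix_mul_assoc)
qed

text \<open>Here \<open>M\<close> and the earlier factors are regular at \<open>s\<close>, and the
  new factor brings a simple pole whose residue is a multiple of \<open>P (Suc i)\<close>. The
  hypothesis on \<open>P (Suc i)\<close> annihilates it.\<close>

lemma elementary_product_inv_residue_zero:
  assumes s: "s = q (Suc i)" "s \<notin> q ` {1..i}"
    and M: "(M \<longlongrightarrow> M0) (at s)"
    and PM: "P (Suc i) ** (elementary_product_inv q r P i s ** M0) = 0"
  shows "((\<lambda>k. (k - s) *\<^sub>C (elementary_product_inv q r P (Suc i) k ** M k)) \<longlongrightarrow> 0) (at s)"
proof -
  let ?C = "elementary_product_inv q r P i" and ?P = "P (Suc i)"
  have CM: "((\<lambda>k. ?C k ** M k) \<longlongrightarrow> ?C s ** M0) (at s)"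
    by (intro tendsto_matrix_mult tendsto_elementary_product_inv s(2) M)
  \<comment> \<open>Since \<open>s = q (Suc i)\<close>, multiplying the new factor by
    \<open>k - s\<close> gives \<open>k - s\<close> times the identity plus
    \<open>s - r (Suc i)\<close> times the projector.\<close>
  have "((\<lambda>k. (k - s) *\<^sub>C (?C k ** M k) + (s - r (Suc i)) *\<^sub>C (?P ** (?C k ** M k)))
      \<longlongrightarrow> (s - s) *\<^sub>C (?C s ** M0) + (s - r (Suc i)) *\<^sub>C (?P ** (?C s ** M0))) (at s)"
    by (intro tendsto_intros CM)
  then have "((\<lambda>k. (k - s) *\<^sub>C (?C k ** M k) + (s - r (Suc i)) *\<^sub>C (?P ** (?C k ** M k)))
      \<longlongrightarrow> 0) (at s)" by (simp add: PM)
  then show ?thesis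
  proof (rule Lim_transform_eventually)
    have "(k - s) *\<^sub>C (?C k ** M k) + (s - r (Suc i)) *\<^sub>C (?P ** (?C k ** M k)) =
        (k - s) *\<^sub>C (elementary_product_inv q r P (Suc i) k ** M k)" if "k \<noteq> s" for k
      using that by (simp add: elementary_factor_def s(1)[symmetric] matrix_add_rdistrib
        cscale_mult_left cscale_add_right cscale_cscale matrix_mul_assoc)
    then show "\<forall>\<^sub>F k in at s. (k - s) *\<^sub>C (?C k ** M k) + (s - r (Suc i)) *\<^sub>C (?P ** (?C k ** M k)) =
        (k - s) *\<^sub>C (elementary_product_inv q r P (Suc i) k ** M k)"
      by (simp add: eventually_at_filter)
  qed
qed

text \<open>Now the pole belongs to \<open>M\<close>. At \<open>s = r (Suc i)\<close> the new
  inverse factor equals \<open>mat 1 - P (Suc i)\<close>, which kills whatever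
  \<open>P (Suc i)\<close> fixes.\<close>

lemma elementary_product_inv_residue_pole:
  assumes s: "s = r (Suc i)" "s \<notin> q ` {1..Suc i}"
    and M: "((\<lambda>k. (k - s) *\<^sub>C M k) \<longlongrightarrow> M0) (at s)"
    and PM: "P (Suc i) ** (elementary_product_inv q r P i s ** M0) = elementary_product_inv q r P i s ** M0"
  shows "((\<lambda>k. (k - s) *\<^sub>C (elementary_product_inv q r P (Suc i) k ** M k)) \<longlongrightarrow> 0) (at s)"
proof -
  let ?C = "elementary_product_inv q r P"
  have "Suc i \<in> {1..Suc i}" by simp
  then have "s \<noteq> q (Suc i)" using s(2) by blast
  then have "(q (Suc i) - s) / (s - q (Suc i)) = -1"
    by (simp add: divide_simps)
  then have "?C (Suc i) s ** M0 = ?C i s ** M0 + (-1) *\<^sub>C (P (Suc i) ** (?C i s ** M0))"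
    by (simp add: elementary_factor_def s(1)[symmetric] matrix_add_rdistrib
        cscale_mult_left matrix_mul_assoc)
  also have "\<dots> = 0" unfolding PM by (simp add: vec_eq_iff)
  finally have "((\<lambda>k. ?C (Suc i) k ** ((k - s) *\<^sub>C M k)) \<longlongrightarrow> 0) (at s)"
    using tendsto_matrix_mult[OF tendsto_elementary_product_inv[OF s(2)] M, of r P] by simp
  then show ?thesis by (simp add: cscale_mult_right)
qed

section \<open>Projectors and factors of degree 1\<close>

text \<open>Split \<open>x\<close> into \<open>P *v x\<close>, which lies in \<open>R\<close> and is
  fixed by \<open>P'\<close>, and \<open>x - P *v x\<close>, which lies in \<open>K\<close> and is
  killed by \<open>P'\<close>. This justifies the definite description in
  \<open>projector\<close>.\<close>

lemma is_projector_unique: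
  assumes P: "is_projector K R P" and P': "is_projector K R P'"
  shows "P = P'"
proof -
  have "P *v x = P' *v x" for x
  proof -
    have "P *v x \<in> R" using P by (auto simp: is_projector_def matrix_image_def)
    then obtain y where y: "P *v x = P' *v y"
      using P' by (auto simp: is_projector_def matrix_image_def)
    have "P' *v (P *v x) = P *v x"
      using P' by (simp add: y matrix_vector_mul_assoc is_projector_def)
    moreover have "P *v (x - P *v x) = 0"
      using P by (simp add: matrix_vector_mult_diff_distrib matrix_vector_mul_assoc is_projector_def)
    then have "x - P *v x \<in> K" using P by (auto simp: is_projector_def matrix_kernel_def)
    then have "P' *v (x - P *v x) = 0" using P' by (auto simp: is_projector_def matrix_kernel_def)
    ultimately show ?thesis by (simp add: matrix_vector_mult_diff_distrib)
  qed
  then show ?thesis by (simp add: matrix_eq)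
qed

lemma is_projector_projector:
  assumes "is_projector K R P"
  shows "is_projector K R (projector K R)"
  unfolding projector_def by (rule theI[of _ P]) (use assms is_projector_unique in blast)+

lemma matrix_product_snoc: "matrix_product (As @ [A]) = matrix_product As ** A"
  by (induction As) (simp_all add: matrix_product_def matrix_mul_assoc)

text \<open>Isolates the projector inside \<open>degree1_factor\<close>, so that each factor of
  degree 1 becomes an \<open>elementary_factor\<close> with an explicit projector.\<close>

definition degree1_projector ::
    "(nat \<Rightarrow> complex) \<Rightarrow> (nat \<Rightarrow> complex) \<Rightarrow>
     (nat \<Rightarrow> (complex^'m) set) \<Rightarrow> (nat \<Rightarrow> (complex^'m) set) \<Rightarrow>
     (complex \<Rightarrow> complex^'m^'m) \<Rightarrow> (complex \<Rightarrow> complex^'m^'m) \<Rightarrow>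
     (nat \<Rightarrow> nat) \<Rightarrow> nat \<Rightarrow> complex^'m^'m"
  where "degree1_projector kp km V U J0p J0m \<sigma> l =
    (let B = degree1_product kp km V U J0p J0m \<sigma> (l - 1)
     in projector (prescribed_kernel kp V J0p B (\<sigma> l)) (prescribed_image km U J0m B (\<sigma> l)))"

lemma degree1_factor_eq:
  "degree1_factor kp km V U J0p J0m \<sigma> (Suc l) =
    elementary_factor (kp (\<sigma> (Suc l))) (km (\<sigma> (Suc l))) (degree1_projector kp km V U J0p J0m \<sigma> (Suc l))"
  by (rule ext, subst degree1_factor.simps)
    (simp add: elementary_factor_def degree1_projector_def degree1_product_def[abs_def] Let_def)

lemma degree1_product_eq:
  "degree1_product kp km V U J0p J0m \<sigma> l =
    elementary_product (kp \<circ> \<sigma>) (km \<circ> \<sigma>) (degree1_projector kp km V U J0p J0m \<sigma>) l"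
proof (induction l)
  case 0
  show ?case by (simp add: fun_eq_iff degree1_product_def matrix_product_def)
next
  case (Suc l)
  have "degree1_product kp km V U J0p J0m \<sigma> (Suc l) k =
      degree1_product kp km V U J0p J0m \<sigma> l k ** degree1_factor kp km V U J0p J0m \<sigma> (Suc l) k" for k
    by (simp add: degree1_product_def matrix_product_snoc)
  with Suc show ?case by (simp add: fun_eq_iff degree1_factor_eq)
qed

section \<open>The dressing factor of degree \<open>N\<close>\<close>

text \<open>The expansion of the inverse yields its residue \<open>N0\<close>. Multiplying
  \<open>M k ** matrix_inv (M k) = mat 1\<close> by \<open>k - s\<close> and letting
  \<open>k\<close> tend to \<open>s\<close> gives \<open>M s ** N0 = 0\<close>.\<close>

lemma singular_at_inv_residue:
  assumes "singular_at M s" and M: "(M \<longlongrightarrow> M s) (at s)"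
  obtains N0 where "((\<lambda>k. (k - s) *\<^sub>C matrix_inv (M k)) \<longlongrightarrow> N0) (at s)"
    and "matrix_image N0 \<subseteq> matrix_kernel (M s)"
proof -
  obtain N0 N1 where inv: "\<forall>\<^sub>F k in at s. invertible (M k)" and
    O: "(\<lambda>k. norm (matrix_inv (M k) - ((1 / (k - s)) *\<^sub>C N0 + N1))) \<in> O[at s](\<lambda>k. norm (k - s))"
    using assms(1) unfolding singular_at_def by blast
  \<comment> \<open>The remainder of the expansion, which is of order \<open>k - s\<close> and hence
    tends to zero.\<close>
  define R where "R k = matrix_inv (M k) - ((1 / (k - s)) *\<^sub>C N0 + N1)" for k
  have "(\<lambda>k. norm (R k)) \<in> O[at s](\<lambda>k. norm (k - s))" using O by (simp add: R_def)
  then obtain c where "\<forall>\<^sub>F k in at s. norm (norm (R k)) \<le> c * norm (norm (k - s))"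
    by (rule landau_o.bigE)
  then have "\<forall>\<^sub>F k in at s. norm (R k) \<le> c * norm (k - s)" by simp
  moreover have "((\<lambda>k. c * norm (k - s)) \<longlongrightarrow> c * norm (s - s)) (at s)"
    by (intro tendsto_intros)
  then have "((\<lambda>k. c * norm (k - s)) \<longlongrightarrow> 0) (at s)" by simp
  ultimately have R: "(R \<longlongrightarrow> 0) (at s)" by (rule Lim_null_comparison)
  have "((\<lambda>k. N0 + (k - s) *\<^sub>C (N1 + R k)) \<longlongrightarrow> N0 + (s - s) *\<^sub>C (N1 + 0)) (at s)"
    by (intro tendsto_intros R)
  then have "((\<lambda>k. N0 + (k - s) *\<^sub>C (N1 + R k)) \<longlongrightarrow> N0) (at s)" by simp
  then have lim: "((\<lambda>k. (k - s) *\<^sub>C matrix_inv (M k)) \<longlongrightarrow> N0) (at s)"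
    by (rule Lim_transform_eventually)
      (auto simp: eventually_at_filter R_def vec_eq_iff field_simps)
  have "((\<lambda>k. M k ** ((k - s) *\<^sub>C matrix_inv (M k))) \<longlongrightarrow> M s ** N0) (at s)"
    by (intro tendsto_matrix_mult M lim)
  moreover have "((\<lambda>k. M k ** ((k - s) *\<^sub>C matrix_inv (M k))) \<longlongrightarrow> 0) (at s)"
  proof (rule Lim_transform_eventually)
    have "((\<lambda>k. (k - s) *\<^sub>C mat 1) \<longlongrightarrow> (s - s) *\<^sub>C (mat 1 :: complex^'a^'a)) (at s)"
      by (intro tendsto_intros)
    then show "((\<lambda>k. (k - s) *\<^sub>C (mat 1 :: complex^'a^'a)) \<longlongrightarrow> 0) (at s)" by simp
    show "\<forall>\<^sub>F k in at s. (k - s) *\<^sub>C mat 1 = M k ** ((k - s) *\<^sub>C matrix_inv (M k))"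
      using inv by eventually_elim (simp add: cscale_mult_right matrix_inv_inverse)
  qed
  ultimately have "M s ** N0 = 0" using tendsto_unique[OF trivial_limit_at] by blast
  then have "matrix_image N0 \<subseteq> matrix_kernel (M s)"
    by (auto simp: matrix_image_def matrix_kernel_def matrix_vector_mul_assoc)
  with lim that show thesis by blast
qed

text \<open>The points \<open>km j\<close> are left out because both sides may have poles
  there.\<close>

theorem theorem2p7:
  fixes N n :: nat
    and J :: "real \<Rightarrow> complex^'m^'m"
    and J0p J0m D :: "complex \<Rightarrow> complex^'m^'m"
    and kp km :: "nat \<Rightarrow> complex"
    and V U :: "nat \<Rightarrow> (complex^'m) set"
  assumes "N \<ge> 1" and "n \<ge> 1" and "CARD('m) = n + 1"
    and "\<forall>x. det (J x) \<noteq> 0"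
    and "regular_rh_solution J J0p J0m"
    and "\<forall>j\<in>{1..N}. Im (kp j) > 0" and "inj_on kp {1..N}"
    and "\<forall>j\<in>{1..N}. Im (km j) < 0" and "inj_on km {1..N}"
    and "\<forall>j\<in>{1..N}. vec.subspace (V j) \<and> vec.subspace (U j)"
    and "\<forall>\<sigma>. \<sigma> permutes {1..N} \<longrightarrow>
           (\<forall>l\<in>{1..N}. degree1_projector_exists kp km V U J0p J0m \<sigma> l)"
    and "is_dressing_factor N kp km V U J J0p J0m D"
  shows "\<forall>\<sigma>. \<sigma> permutes {1..N} \<longrightarrow>
           (\<forall>k. k \<notin> km ` {1..N} \<longrightarrow>
              D k = matrix_product (map (\<lambda>l. degree1_factor kp km V U J0p J0m \<sigma> l k) [1..<N + 1]))"
proof (intro allI impI)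
  fix \<sigma> k
  assume \<sigma>: "\<sigma> permutes {1..N}" and k: "k \<notin> km ` {1..N}"
  from \<open>is_dressing_factor N kp km V U J J0p J0m D\<close> obtain Jp Jm
    where zeroes: "rh_solution_with_zeroes N kp km J Jp Jm"
      and Im: "\<And>j. j \<in> {1..N} \<Longrightarrow> matrix_image (Jp (kp j)) = V j"
      and Ker: "\<And>j. j \<in> {1..N} \<Longrightarrow> matrix_kernel (Jm (km j)) = U j"
      and Jp: "\<And>k. Im k \<ge> 0 \<Longrightarrow> Jp k = J0p k ** D k"
      and Jm: "\<And>k. Im k \<le> 0 \<Longrightarrow> k \<notin> km ` {1..N} \<Longrightarrow>
         invertible (D k) \<and> Jm k = matrix_inv (D k) ** J0m k"
    unfolding is_dressing_factor_def by blast
  have sol: "rh_solution J Jp Jm" and sol0: "rh_solution J J0p J0m"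
    and J0p_nz: "\<And>k. Im k \<ge> 0 \<Longrightarrow> det (J0p k) \<noteq> 0"
    and J0m_nz: "\<And>k. Im k \<le> 0 \<Longrightarrow> det (J0m k) \<noteq> 0"
    and Jm_nz: "\<And>k. Im k \<le> 0 \<Longrightarrow> k \<notin> km ` {1..N} \<Longrightarrow> det (Jm k) \<noteq> 0"
    and sing: "\<And>j. j \<in> {1..N} \<Longrightarrow> singular_at Jm (km j)"
    using zeroes \<open>regular_rh_solution J J0p J0m\<close>
    by (auto simp: rh_solution_with_zeroes_def regular_rh_solution_def)

  \<comment> \<open>Holomorphy of \<open>D\<close> off the points \<open>km j\<close> and its limit
    at infinity\<close>
  have Dp: "D k = matrix_inv (J0p k) ** Jp k" if "Im k \<ge> 0" for k
    using J0p_nz[OF that] Jp[OF that]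
    by (simp add: matrix_mul_assoc matrix_inv_inverse invertible_det_nz)
  have Dm: "D k = J0m k ** matrix_inv (Jm k)" if "Im k \<le> 0" "k \<notin> km ` {1..N}" for k
  proof -
    have "D k ** Jm k = J0m k"
      using Jm[OF that] by (simp add: matrix_mul_assoc matrix_inv_inverse)
    then have "J0m k ** matrix_inv (Jm k) = D k ** (Jm k ** matrix_inv (Jm k))"
      by (simp add: matrix_mul_assoc)
    then show ?thesis
      using Jm_nz[OF that] by (simp add: matrix_inv_inverse invertible_det_nz)
  qed
  have sol_props:
    "matrix_holomorphic_on J0p {k. Im k > 0}" "continuous_on {k. Im k \<ge> 0} J0p"
    "matrix_holomorphic_on J0m {k. Im k < 0}" "continuous_on {k. Im k \<le> 0} J0m"
    "(J0p \<longlongrightarrow> mat 1) (inf at_infinity (principal {k. Im k \<ge> 0}))"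
    "(J0m \<longlongrightarrow> mat 1) (inf at_infinity (principal {k. Im k \<le> 0}))"
    "matrix_holomorphic_on Jp {k. Im k > 0}" "continuous_on {k. Im k \<ge> 0} Jp"
    "matrix_holomorphic_on Jm {k. Im k < 0}" "continuous_on {k. Im k \<le> 0} Jm"
    "(Jp \<longlongrightarrow> mat 1) (inf at_infinity (principal {k. Im k \<ge> 0}))"
    "(Jm \<longlongrightarrow> mat 1) (inf at_infinity (principal {k. Im k \<le> 0}))"
    using sol sol0 by (auto simp: rh_solution_def)

  let ?S = "- km ` {1..N}"
  have S: "open ?S" by (intro open_Compl finite_imp_closed) auto
  \<comment> \<open>The formulas \<open>Dp\<close> and \<open>Dm\<close> are continuous up to the
    real line from their own sides. Both describe the same \<open>D\<close> there, so the two closed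
    pieces glue; this continuity is what pasting needs.\<close>
  have contD: "continuous_on ?S D"
  proof -
    have "continuous_on {k. Im k \<ge> 0} (\<lambda>k. matrix_inv (J0p k) ** Jp k)"
      using J0p_nz by (intro continuous_on_matrix_mult continuous_on_matrix_inv sol_props) auto
    then have p: "continuous_on {k \<in> ?S. Im k \<ge> 0} D"
      by (rule continuous_on_cong_simp[THEN iffD2, OF refl, rotated, OF continuous_on_subset])
        (auto simp: Dp simp_implies_def)
    have "continuous_on {k \<in> ?S. Im k \<le> 0} (\<lambda>k. J0m k ** matrix_inv (Jm k))"
      using Jm_nz by (intro continuous_on_matrix_mult continuous_on_matrix_inv
        continuous_on_subset[OF sol_props(4)] continuous_on_subset[OF sol_props(10)]) auto
    then have m: "continuous_on {k \<in> ?S. Im k \<le> 0} D"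
      by (rule continuous_on_cong_simp[THEN iffD2, OF refl, rotated])
        (auto simp: Dm simp_implies_def)
    have "closedin (top_of_set ?S) {k \<in> ?S. 0 \<le> Im k}" "closedin (top_of_set ?S) {k \<in> ?S. Im k \<le> 0}"
      using closed_halfspace_Im_ge[of 0] closed_halfspace_Im_le[of 0]
      by (auto simp: closedin_closed Collect_conj_eq)
    moreover have "?S = {k \<in> ?S. 0 \<le> Im k} \<union> {k \<in> ?S. Im k \<le> 0}" by auto
    ultimately show ?thesis using continuous_on_Un_local[OF _ _ p m] by metis
  qed
  have holD: "matrix_holomorphic_on D ?S"
  proof (rule matrix_holomorphic_on_paste[OF S _ _ contD])
    have "matrix_holomorphic_on (\<lambda>k. matrix_inv (J0p k) ** Jp k) {k. Im k > 0}"
      using J0p_nz by (intro matrix_holomorphic_on_mult matrix_holomorphic_on_inv sol_props) auto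
    then have "matrix_holomorphic_on D {k. Im k > 0}"
      by (subst matrix_holomorphic_on_cong[OF Dp]) auto
    then show "matrix_holomorphic_on D (?S \<inter> {k. Im k > 0})"
      by (rule matrix_holomorphic_on_subset) auto
    have "matrix_holomorphic_on (\<lambda>k. J0m k ** matrix_inv (Jm k)) (?S \<inter> {k. Im k < 0})"
      using Jm_nz by (intro matrix_holomorphic_on_mult matrix_holomorphic_on_inv
        matrix_holomorphic_on_subset[OF sol_props(3)] matrix_holomorphic_on_subset[OF sol_props(9)]) auto
    then show "matrix_holomorphic_on D (?S \<inter> {k. Im k < 0})"
      by (subst matrix_holomorphic_on_cong[OF Dm]) auto
  qed
  have infD: "(D \<longlongrightarrow> mat 1) at_infinity"
  proof (rule tendsto_inf_principal_Un)
    have inv1: "matrix_inv (mat 1) = (mat 1 :: complex^'m^'m)"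
      by (rule matrix_inv_eqI) simp
    have "((\<lambda>k. matrix_inv (J0p k) ** Jp k) \<longlongrightarrow> matrix_inv (mat 1) ** mat 1)
        (inf at_infinity (principal {k. Im k \<ge> 0}))"
      by (intro tendsto_matrix_mult tendsto_matrix_inv sol_props) auto
    then show "(D \<longlongrightarrow> mat 1) (inf at_infinity (principal {k. Im k \<ge> 0}))"
      unfolding inv1 matrix_mul_lid
      by (rule Lim_transform_eventually) (simp add: eventually_inf_principal Dp)
    have "((\<lambda>k. J0m k ** matrix_inv (Jm k)) \<longlongrightarrow> mat 1 ** matrix_inv (mat 1))
        (inf at_infinity (principal {k. Im k \<le> 0}))"
      by (intro tendsto_matrix_mult tendsto_matrix_inv sol_props) auto
    \<comment> \<open>\<open>Dm\<close> is available only off the points \<open>km j\<close>, which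
      form a bounded set and so do not affect the limit.\<close>
    moreover have "\<forall>\<^sub>F k in at_infinity. k \<notin> km ` {1..N}"
    proof -
      have "bounded (km ` {1..N})" by (simp add: finite_imp_bounded)
      then obtain B where "\<And>z. z \<in> km ` {1..N} \<Longrightarrow> norm z \<le> B" by (auto simp: bounded_iff)
      then have "\<forall>z. norm z \<ge> B + 1 \<longrightarrow> z \<notin> km ` {1..N}" by fastforce
      then show ?thesis unfolding eventually_at_infinity by blast
    qed
    then have "\<forall>\<^sub>F k in inf at_infinity (principal {k. Im k \<le> 0}). J0m k ** matrix_inv (Jm k) = D k"
      unfolding eventually_inf_principal by eventually_elim (simp add: Dm)
    ultimately show "(D \<longlongrightarrow> mat 1) (inf at_infinity (principal {k. Im k \<le> 0}))"
      unfolding inv1 matrix_mul_lid by (rule Lim_transform_eventually)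
    show "{k. 0 \<le> Im k} \<union> {k. Im k \<le> 0} = UNIV" by auto
  qed

  \<comment> \<open>The zeros, poles and projectors in the order given by
    \<open>\<sigma>\<close>\<close>
  define q where "q = kp \<circ> \<sigma>"
  define r where "r = km \<circ> \<sigma>"
  define P where "P = degree1_projector kp km V U J0p J0m \<sigma>"
  let ?B = "elementary_product q r P" and ?C = "elementary_product_inv q r P"
  have \<sigma>N: "\<sigma> ` {1..N} = {1..N}" and inj\<sigma>: "inj_on \<sigma> {1..N}"
    using \<sigma> by (auto simp: permutes_image intro: permutes_inj_on)
  have \<sigma>_in: "\<sigma> j \<in> {1..N}" if "j \<in> {1..N}" for j
    using \<sigma>N that by blast
  have qN: "q ` {1..N} = kp ` {1..N}" and rN: "r ` {1..N} = km ` {1..N}"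
    using \<sigma>N by (metis q_def image_comp, metis r_def image_comp)
  have q_inj: "inj_on q {1..N}" and r_inj: "inj_on r {1..N}"
    unfolding q_def r_def using \<sigma>N inj\<sigma> assms(7,9) by (auto intro!: comp_inj_on)
  have qr: "q i \<noteq> r j" if "i \<in> {1..N}" "j \<in> {1..N}" for i j
  proof -
    have "Im (q i) > 0" "Im (r j) < 0"
      using assms(6,8) \<sigma>_in[OF that(1)] \<sigma>_in[OF that(2)] by (auto simp: q_def r_def)
    then show ?thesis by auto
  qed

  \<comment> \<open>The index is \<open>Suc i\<close> so that the bracket of preceding factors is
    the product of length \<open>i\<close>. The assumed existence of a projector gives the one
    chosen by \<open>projector\<close> its defining properties.\<close>
  have P: "is_projector (prescribed_kernel kp V J0p (?B i) (\<sigma> (Suc i)))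
      (prescribed_image km U J0m (?B i) (\<sigma> (Suc i))) (P (Suc i))"
    if "Suc i \<in> {1..N}" for i
  proof -
    have "degree1_projector_exists kp km V U J0p J0m \<sigma> (Suc i)"
      using assms(11) \<sigma> that by blast
    moreover have B: "degree1_product kp km V U J0p J0m \<sigma> i = ?B i"
      by (simp add: degree1_product_eq q_def r_def P_def)
    moreover have "P (Suc i) = projector (prescribed_kernel kp V J0p (?B i) (\<sigma> (Suc i)))
        (prescribed_image km U J0m (?B i) (\<sigma> (Suc i)))"
      by (simp add: P_def[THEN fun_cong] degree1_projector_def Let_def flip: B)
    ultimately show ?thesis
      by (auto simp: degree1_projector_exists_def Let_def dest: is_projector_projector)
  qed
  have PP: "P j ** P j = P j" if "j \<in> {1..N}" for j
    using P[of "j - 1"] that by (simp add: is_projector_def)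
  \<comment> \<open>The prescribed subspaces are stated with \<open>matrix_inv\<close> of the
    preceding product. At a point that is neither a zero nor a pole of the preceding factors, this
    is the explicit inverse \<open>?C i s\<close>.\<close>
  have inv_BC: "matrix_inv (?B i s) = ?C i s"
    if "Suc i \<in> {1..N}" "s \<notin> q ` {1..i}" "s \<notin> r ` {1..i}" for i s
    using that PP by (intro matrix_inv_eqI elementary_product_inverse) auto

  \<comment> \<open>Removal of all singularities of the quotient, and Liouville's theorem\<close>
  define F where "F k = ?C N k ** D k" for k
  define K where "K = kp ` {1..N} \<union> km ` {1..N}"
  have K_eq: "K = q ` {1..N} \<union> r ` {1..N}" by (simp only: K_def qN rN)
  have F1: "F k = mat 1" if "k \<notin> K" for k
  proof (rule matrix_Liouville_off_finite[OF _ _ _ _ that])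
    show "finite K" by (simp add: K_def)
    show "matrix_holomorphic_on F (- K)"
      unfolding F_def
      by (intro matrix_holomorphic_on_mult matrix_holomorphic_on_elementary_product_inv
          matrix_holomorphic_on_subset[OF holD]) (use K_eq K_def in blast)+
    show "(F \<longlongrightarrow> mat 1) at_infinity"
      using tendsto_matrix_mult[OF tendsto_elementary_product_inv_infinity infD] by (simp add: F_def[abs_def])
    show "((\<lambda>k. (k - s) *\<^sub>C F k) \<longlongrightarrow> 0) (at s)" if "s \<in> K" for s
    proof -
      from that obtain l where l: "l \<in> {1..N}" "s = q l \<or> s = r l"
        unfolding K_eq by blast
      then obtain i where "l = Suc i" by (cases l) auto
      with l have i: "Suc i \<in> {1..N}" and s: "s = q (Suc i) \<or> s = r (Suc i)" by simp_all
      let ?j = "\<sigma> (Suc i)"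
      have j: "?j \<in> {1..N}" using \<sigma>_in i by blast
      have iN: "{1..i} \<subseteq> {1..N}" "{1..Suc i} \<subseteq> {1..N}" "{Suc i<..N} \<subseteq> {1..N}" using i by auto
      \<comment> \<open>It suffices to remove the singularity with the first \<open>Suc i\<close>
        inverse factors: the later ones have no pole at \<open>s\<close>, so the conclusion carries
        over to all \<open>N\<close>.\<close>
      have "((\<lambda>k. (k - s) *\<^sub>C (?C (Suc i) k ** D k)) \<longlongrightarrow> 0) (at s) \<and> s \<notin> q ` {Suc i<..N}"
        using s
      proof
        assume zero: "s = q (Suc i)"
        have sq: "s \<notin> q ` {1..i}" "s \<notin> q ` {Suc i<..N}"
          unfolding zero inj_on_image_mem_iff[OF q_inj i iN(1)] inj_on_image_mem_iff[OF q_inj i iN(3)]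
          by auto
        have sr: "s \<notin> r ` {1..N}" using qr[OF i] unfolding zero by blast
        then have sr': "s \<notin> r ` {1..i}" using iN(1) by blast
        have s_eq: "s = kp ?j" by (simp add: zero q_def)
        then have s_im: "Im s \<ge> 0" using assms(6) j by (simp add: less_imp_le)
        have "(D \<longlongrightarrow> D s) (at s)"
          using sr unfolding rN by (intro matrix_holomorphic_on_imp_tendsto[OF holD S]) simp
        \<comment> \<open>\<open>D s\<close> is \<open>matrix_inv (J0p s) ** Jp s\<close>, and the
          image of \<open>Jp s\<close> is \<open>V ?j\<close>. Hence \<open>?C i s ** D s\<close>
          maps into the prescribed kernel.\<close>
        moreover have "P (Suc i) ** (?C i s ** D s) = 0"
        proof -
          have "P (Suc i) *v (?C i s *v (D s *v x)) = 0" for x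
          proof -
            have "Jp s *v x \<in> V ?j" using Im[OF j] by (auto simp: s_eq matrix_image_def)
            then have "(matrix_inv (?B i s) ** matrix_inv (J0p s)) *v (Jp s *v x)
                \<in> prescribed_kernel kp V J0p (?B i) ?j"
              by (auto simp: prescribed_kernel_def s_eq)
            then have "?C i s *v (D s *v x) \<in> prescribed_kernel kp V J0p (?B i) ?j"
              by (simp add: inv_BC[OF i sq(1) sr'] Dp[OF s_im] matrix_vector_mul_assoc matrix_mul_assoc)
            then show ?thesis using P[OF i] by (auto simp: is_projector_def matrix_kernel_def)
          qed
          then show ?thesis by (simp add: matrix_eq matrix_vector_mul_assoc matrix_mul_assoc)
        qed
        ultimately show ?thesis
          using sq by (intro conjI elementary_product_inv_residue_zero[of s q i, OF zero sq(1)])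
      next
        assume pole: "s = r (Suc i)"
        have sr: "s \<notin> r ` {1..i}"
          unfolding pole inj_on_image_mem_iff[OF r_inj i iN(1)] by auto
        have "s \<notin> q ` {1..N}" using qr[OF _ i] by (metis imageE pole)
        then have sq: "s \<notin> q ` {1..i}" "s \<notin> q ` {1..Suc i}" "s \<notin> q ` {Suc i<..N}"
          using iN by blast+
        have s_eq: "s = km ?j" by (simp add: pole r_def)
        then have s_im: "Im s < 0" using assms(8) j by simp
        have op: "open {k. Im k < 0}" by (rule open_halfspace_Im_lt)
        have "(Jm \<longlongrightarrow> Jm s) (at s)"
          using s_im by (intro matrix_holomorphic_on_imp_tendsto[OF sol_props(9) op]) simp
        then obtain N0 where N0: "((\<lambda>k. (k - s) *\<^sub>C matrix_inv (Jm k)) \<longlongrightarrow> N0) (at s)"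
          "matrix_image N0 \<subseteq> matrix_kernel (Jm s)"
          using singular_at_inv_residue sing[OF j] s_eq by blast
        \<comment> \<open>Near \<open>s\<close> the function \<open>D\<close> is \<open>J0m\<close>
          times the inverse of \<open>Jm\<close>, so its residue is \<open>J0m s ** N0\<close>, with
          the image of \<open>N0\<close> inside the kernel \<open>U ?j\<close> of
          \<open>Jm s\<close>.\<close>
        have "((\<lambda>k. J0m k ** ((k - s) *\<^sub>C matrix_inv (Jm k))) \<longlongrightarrow> J0m s ** N0) (at s)"
          using s_im by (intro tendsto_matrix_mult N0 matrix_holomorphic_on_imp_tendsto[OF sol_props(3) op]) simp
        moreover have "\<forall>\<^sub>F k in at s. J0m k ** ((k - s) *\<^sub>C matrix_inv (Jm k)) = (k - s) *\<^sub>C D k"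
        proof -
          \<comment> \<open>A neighbourhood of \<open>s\<close> free of the other \<open>km\<close>
            points; \<open>s\<close> itself is excluded by the punctured filter.\<close>
          have "open ({k. Im k < 0} - (km ` {1..N} - {s}))"
            using op by (intro open_Diff finite_imp_closed) auto
          then have "\<forall>\<^sub>F k in nhds s. k \<in> {k. Im k < 0} - (km ` {1..N} - {s})"
            by (rule eventually_nhds_in_open) (use s_im in simp)
          then show ?thesis unfolding eventually_at_filter
            by eventually_elim (auto simp: Dm cscale_mult_right)
        qed
        ultimately have "((\<lambda>k. (k - s) *\<^sub>C D k) \<longlongrightarrow> J0m s ** N0) (at s)"
          by (rule Lim_transform_eventually)
        \<comment> \<open>The residue of \<open>D\<close>, transported by \<open>?C i s\<close>,
          lands in the prescribed image, on which the projector acts as the identity.\<close>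
        moreover have "P (Suc i) ** (?C i s ** (J0m s ** N0)) = ?C i s ** (J0m s ** N0)"
        proof -
          have "P (Suc i) *v (?C i s *v (J0m s *v (N0 *v x))) = ?C i s *v (J0m s *v (N0 *v x))" for x
          proof -
            have "N0 *v x \<in> U ?j" using N0(2) Ker[OF j] by (auto simp: s_eq matrix_image_def)
            then have "(matrix_inv (?B i s) ** J0m s) *v (N0 *v x)
                \<in> prescribed_image km U J0m (?B i) ?j"
              by (auto simp: prescribed_image_def s_eq)
            then have "?C i s *v (J0m s *v (N0 *v x)) \<in> prescribed_image km U J0m (?B i) ?j"
              by (simp add: inv_BC[OF i sq(1) sr] matrix_vector_mul_assoc matrix_mul_assoc)
            then obtain y where "?C i s *v (J0m s *v (N0 *v x)) = P (Suc i) *v y"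
              using P[OF i] by (auto simp: is_projector_def matrix_image_def)
            then show ?thesis using PP[OF i] by (simp add: matrix_vector_mul_assoc)
          qed
          then show ?thesis by (simp add: matrix_eq matrix_vector_mul_assoc matrix_mul_assoc)
        qed
        ultimately show ?thesis
          using sq by (intro conjI elementary_product_inv_residue_pole[of s r i q, OF pole sq(2)])
      qed
      then show ?thesis
        unfolding F_def using i
        by - (rule elementary_product_inv_residue_mono[of s q r P "Suc i" D], simp_all)
    qed
  qed

  \<comment> \<open>From the trivial quotient to the factorization\<close>
  have DB: "D k = ?B N k" if "k \<notin> K" for k
  proof -
    have "?B N k ** ?C N k = mat 1"
      using that PP by (intro elementary_product_inverse) (auto simp: K_eq)
    moreover have "?B N k ** (?C N k ** D k) = ?B N k" using F1[OF that] by (simp add: F_def)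
    ultimately show ?thesis by (simp add: matrix_mul_assoc)
  qed
  \<comment> \<open>The given \<open>k\<close> may be one of the \<open>kp j\<close>, where
    \<open>DB\<close> says nothing. Both sides are holomorphic off the \<open>km j\<close> and agree
    on a punctured neighbourhood of \<open>k\<close>, so their values at \<open>k\<close>
    coincide.\<close>
  have "D k = ?B N k"
  proof (rule tendsto_unique[OF trivial_limit_at])
    show "(D \<longlongrightarrow> D k) (at k)" using k by (intro matrix_holomorphic_on_imp_tendsto[OF holD S]) simp
    have "matrix_holomorphic_on (?B N) ?S"
      by (rule matrix_holomorphic_on_elementary_product) (simp only: rN Compl_disjoint)
    then have "(?B N \<longlongrightarrow> ?B N k) (at k)"
      using k by (intro matrix_holomorphic_on_imp_tendsto[OF _ S]) simp_all
    moreover have "\<forall>\<^sub>F z in at k. ?B N z = D z"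
    proof -
      have "open (- (K - {k}))" by (intro open_Compl finite_imp_closed) (simp add: K_def)
      then have "\<forall>\<^sub>F z in nhds k. z \<in> - (K - {k})"
        by (rule eventually_nhds_in_open) simp
      then show ?thesis unfolding eventually_at_filter by eventually_elim (auto simp: DB)
    qed
    ultimately show "(D \<longlongrightarrow> ?B N k) (at k)" by (rule Lim_transform_eventually)
  qed
  also have "\<dots> = degree1_product kp km V U J0p J0m \<sigma> N k"
    by (simp add: degree1_product_eq q_def r_def P_def)
  finally show "D k = matrix_product (map (\<lambda>l. degree1_factor kp km V U J0p J0m \<sigma> l k) [1..<N + 1])"
    by (simp add: degree1_product_def)
qed

end
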